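(* For all integers $n\ge 0$, the Padovan hyperbolic spinors $\psi_n$ and the Perrin hyperbolic spinors $\phi_n$ satisfy $$\begin{pmatrix}\psi_n\\ \psi_{n+1}\\ \psi_{n+2}\end{pmatrix}=\begin{pmatrix}0&1&0\\0&0&1\\1&1&0\end{pmatrix}^{n}\begin{pmatrix}\psi_0\\ \psi_1\\ \psi_2\end{pmatrix},\qquad \begin{pmatrix}\phi_n\\ \phi_{n+1}\\ \phi_{n+2}\end{pmatrix}=\begin{pmatrix}0&1&0\\0&0&1\\1&1&0\end{pmatrix}^{n}\begin{pmatrix}\phi_0\\ \phi_1\\ \phi_2\end{pmatrix}.$$
   Context: Hyperbolic numbers are expressions $a+bj$ with $a,b\in\mathbb{R}$ and a unit $j\notin\mathbb{R}$, $j^2=1$; they form a commutative ring. A hyperbolic spinor is a column vector with two hyperbolic number components, with componentwise addition and scalar multiplication. A $3\times 3$ integer matrix acts on a triple of hyperbolic spinors by the usual matrix-vector rule, the entries of the matrix acting on spinors as scalars. The Padovan numbers $(P_n)_{n\ge 0}$ are defined by $P_0=P_1=P_2=1$ and $P_{n+3}=P_{n+1}+P_n$ for $n\ge0$. The Perrin numbers $(R_n)_{n\ge 0}$ are defined by $R_0=3$, $R_1=0$, $R_2=2$ and $R_{n+3}=R_{n+1}+R_n$ for $n\ge 0$. The $n$-th Padovan hyperbolic spinor and the $n$-th Perrin hyperbolic spinor are $$\psi_n=\begin{bmatrix}P_n+P_{n+3}j\\ -P_{n+1}+P_{n+2}j\end{bmatrix},\qquad \phi_n=\begin{bmatrix}R_n+R_{n+3}j\\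 -R_{n+1}+R_{n+2}j\end{bmatrix}.$$ *)

theory Defs
  imports "HOL-Analysis.Analysis"
begin

(* Hyp a b is the hyperbolic number a + b j. *)
datatype hyperbolic = Hyp (hyp_re: real) (hyp_im: real)

lemma hyperbolic_eq_iff: "z = w \<longleftrightarrow> hyp_re z = hyp_re w \<and> hyp_im z = hyp_im w"
  by (cases z; cases w) simp

instantiation hyperbolic :: comm_ring_1
begin

definition zero_hyperbolic :: hyperbolic where
  "0 = Hyp 0 0"

definition one_hyperbolic :: hyperbolic where
  "1 = Hyp 1 0"

definition plus_hyperbolic :: "hyperbolic \<Rightarrow> hyperbolic \<Rightarrow> hyperbolic" where
  "z + w = Hyp (hyp_re z + hyp_re w) (hyp_im z + hyp_im w)"

definition uminus_hyperbolic :: "hyperbolic \<Rightarrow> hyperbolic" where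
  "- z = Hyp (- hyp_re z) (- hyp_im z)"

definition minus_hyperbolic :: "hyperbolic \<Rightarrow> hyperbolic \<Rightarrow> hyperbolic" where
  "z - w = Hyp (hyp_re z - hyp_re w) (hyp_im z - hyp_im w)"

(* (a + b j) (c + d j) = (a c + b d) + (a d + b c) j, since j^2 = 1 *)
definition times_hyperbolic :: "hyperbolic \<Rightarrow> hyperbolic \<Rightarrow> hyperbolic" where
  "z * w = Hyp (hyp_re z * hyp_re w + hyp_im z * hyp_im w)
               (hyp_re z * hyp_im w + hyp_im z * hyp_re w)"

instance
  by standard
     (simp_all add: hyperbolic_eq_iff zero_hyperbolic_def one_hyperbolic_def
        plus_hyperbolic_def uminus_hyperbolic_def minus_hyperbolic_def
        times_hyperbolic_def algebra_simps)

end

definition hyp_j :: hyperbolic where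
  "hyp_j = Hyp 0 1"

lemma hyp_j_squared: "hyp_j ^ 2 = 1"
  by (simp add: hyp_j_def power2_eq_square times_hyperbolic_def one_hyperbolic_def)

lemma hyp_j_not_real: "hyp_j \<noteq> Hyp a 0"
  by (simp add: hyp_j_def)

lemma Hyp_conv: "Hyp a b = Hyp a 0 + Hyp b 0 * hyp_j"
  by (simp add: hyp_j_def plus_hyperbolic_def times_hyperbolic_def)

lemma of_int_hyperbolic: "of_int k = Hyp (of_int k) 0"
proof -
  have of_nat: "of_nat n = Hyp (of_nat n) 0" for n
    by (induction n)
       (simp_all add: zero_hyperbolic_def one_hyperbolic_def plus_hyperbolic_def)
  show ?thesis
    by (cases k rule: int_cases2) (simp_all add: of_nat uminus_hyperbolic_def)
qed

type_synonym hyp_spinor = "hyperbolic ^ 2"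

fun padovan :: "nat \<Rightarrow> int" where
  "padovan 0 = 1"
| "padovan (Suc 0) = 1"
| "padovan (Suc (Suc 0)) = 1"
| "padovan (Suc (Suc (Suc n))) = padovan (Suc n) + padovan n"

fun perrin :: "nat \<Rightarrow> int" where
  "perrin 0 = 3"
| "perrin (Suc 0) = 0"
| "perrin (Suc (Suc 0)) = 2"
| "perrin (Suc (Suc (Suc n))) = perrin (Suc n) + perrin n"

definition padovan_spinor :: "nat \<Rightarrow> hyp_spinor" where
  "padovan_spinor n = vector
     [of_int (padovan n) + of_int (padovan (n + 3)) * hyp_j,
      - of_int (padovan (n + 1)) + of_int (padovan (n + 2)) * hyp_j]"

definition perrin_spinor :: "nat \<Rightarrow> hyp_spinor" where
  "perrin_spinor n = vector
     [of_int (perrin n) + of_int (perrin (n + 3)) * hyp_j,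
      - of_int (perrin (n + 1)) + of_int (perrin (n + 2)) * hyp_j]"

(* On the type 'a ^ 'n ^ 'n the operations * and ^ are entrywise,
   hence a separate power for the matrix product **. *)
primrec matrix_pow :: "'a::semiring_1 ^ 'n ^ 'n \<Rightarrow> nat \<Rightarrow> 'a ^ 'n ^ 'n" where
  "matrix_pow A 0 = mat 1"
| "matrix_pow A (Suc n) = A ** matrix_pow A n"

(* The library product *v needs matrix and vector entries of the same type; here
   integer entries act on spinors as scalars through the embedding into the
   hyperbolic numbers. *)
definition spinor_mult :: "int ^ 3 ^ 3 \<Rightarrow> hyp_spinor ^ 3 \<Rightarrow> hyp_spinor ^ 3" where
  "spinor_mult A v = (\<chi> i. \<Sum>k\<in>UNIV. of_int (A $ i $ k) *s (v $ k))"

definition companion_matrix :: "int ^ 3 ^ 3" where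
  "companion_matrix = vector [vector [0, 1, 0],
                              vector [0, 0, 1],
                              vector [1, 1, 0]]"

end

theory Submission
  imports Defs
begin

text \<open>Both spinor sequences inherit the recurrence f(n+3) = f(n+1) + f(n) from their integer
  coefficients. For any such f, the companion matrix shifts the window (f(n), f(n+1), f(n+2)) by one
  place (\<open>spinor_mult_companion_matrix\<close>). Since \<open>spinor_mult\<close> is an action
  of integer matrices (\<open>spinor_mult_mat_1\<close>, \<open>spinor_mult_assoc\<close>), n shifts
  amount to the n-th power, by induction.\<close>

lemma spinor_mult_mat_1: "spinor_mult (mat 1) v = v"
  by (simp add: spinor_mult_def mat_def vec_eq_iff of_bool_def if_distrib if_distribR
      cong: if_cong)

text \<open>Componentwise, \<open>of_int\<close> respects sums and products, so both sides expand to
  one double sum with the order of summation exchanged.\<close>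

lemma spinor_mult_assoc: "spinor_mult (A ** B) v = spinor_mult A (spinor_mult B v)"
proof -
  have "(\<Sum>k\<in>UNIV. (\<Sum>l\<in>UNIV. of_int (A $ i $ l) * of_int (B $ l $ k)) * v $ k $ c)
      = (\<Sum>l\<in>UNIV. of_int (A $ i $ l) * (\<Sum>k\<in>UNIV. of_int (B $ l $ k) * v $ k $ c))"
    for i :: 3 and c :: 2
    by (simp add: sum_distrib_left sum_distrib_right mult.assoc)
       (rule sum.swap)
  then show ?thesis
    by (simp add: spinor_mult_def matrix_matrix_mult_def vec_eq_iff)
qed

text \<open>The first two rows shift the window; the last row encodes the recurrence.\<close>

lemma spinor_mult_companion_matrix:
  "spinor_mult companion_matrix (vector [x, y, z]) = vector [y, z, y + x]"
  by (simp add: spinor_mult_def companion_matrix_def vec_eq_iff forall_3 sum_3)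

text \<open>Only the recurrence matters, not the initial values, so Padovan and Perrin are treated
  together.\<close>

lemma spinor_recurrence_matrix_pow:
  fixes f :: "nat \<Rightarrow> hyp_spinor"
  assumes "\<And>n. f (n + 3) = f (n + 1) + f n"
  shows "(vector [f n, f (n + 1), f (n + 2)] :: hyp_spinor ^ 3)
    = spinor_mult (matrix_pow companion_matrix n) (vector [f 0, f 1, f 2])"
proof (induction n)
  case 0
  show ?case by (simp add: spinor_mult_mat_1 numeral_2_eq_2)
next
  case (Suc n)
  have "(vector [f (Suc n), f (Suc n + 1), f (Suc n + 2)] :: hyp_spinor ^ 3)
      = vector [f (n + 1), f (n + 2), f (n + 1) + f n]"
    using assms[of n] by (simp add: numeral_eq_Suc)
  also have "\<dots> = spinor_mult companion_matrix (vector [f n, f (n + 1), f (n + 2)])"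
    by (simp only: spinor_mult_companion_matrix)
  \<comment> \<open>\<open>matrix_pow\<close> adds its new factor on the left, so by associativity
    that factor acts on the window given by the induction hypothesis.\<close>
  finally show ?case
    by (simp only: Suc.IH matrix_pow.simps spinor_mult_assoc)
qed

text \<open>Each component is a fixed combination of shifted Padovan numbers, and every shift
  satisfies the same linear recurrence.\<close>

lemma padovan_spinor_recurrence:
  "padovan_spinor (n + 3) = padovan_spinor (n + 1) + padovan_spinor n"
  by (simp add: padovan_spinor_def vec_eq_iff forall_2 numeral_eq_Suc algebra_simps)

lemma perrin_spinor_recurrence:
  "perrin_spinor (n + 3) = perrin_spinor (n + 1) + perrin_spinor n"
  by (simp add: perrin_spinor_def vec_eq_iff forall_2 numeral_eq_Suc algebra_simps)

theorem theorem17: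
  fixes n :: nat
  shows "(vector [padovan_spinor n, padovan_spinor (n + 1), padovan_spinor (n + 2)] :: hyp_spinor ^ 3)
           = spinor_mult (matrix_pow companion_matrix n)
               (vector [padovan_spinor 0, padovan_spinor 1, padovan_spinor 2])
       \<and> (vector [perrin_spinor n, perrin_spinor (n + 1), perrin_spinor (n + 2)] :: hyp_spinor ^ 3)
           = spinor_mult (matrix_pow companion_matrix n)
               (vector [perrin_spinor 0, perrin_spinor 1, perrin_spinor 2])"
  using spinor_recurrence_matrix_pow[of padovan_spinor, OF padovan_spinor_recurrence]
    spinor_recurrence_matrix_pow[of perrin_spinor, OF perrin_spinor_recurrence]
  by blast

end
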